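(* If $S$ is the center of the map $\mathsf{M}=T_P\circ K^{-1}\circ T_{P'}$, then $\gamma_P(P)=S$.
   Context: We work in the Euclidean plane extended by its line at infinity $l_\infty$; affine maps are extended to $l_\infty$. $ABC$ is an ordinary non-degenerate triangle; its sides are the lines $BC, CA, AB$. $X_1X_2\cdot Y_1Y_2$ denotes the intersection of two lines. $K$ is the complement map (homothety with center the centroid $G$ and ratio $-1/2$); $K^{-1}(ABC)$ is the anticomplementary triangle. $\iota$ is the isotomic map, $(x:y:z)\mapsto(1/x:1/y:1/z)$ in barycentric coordinates. $P$ is a point (ordinary or infinite) not on the sides of $ABC$ or $K^{-1}(ABC)$; $P'=\iota(P)$, $Q=K(P')$. $DEF$ is the cevian triangle of $P$ ($D=AP\cdot BC$, $E=BP\cdot CA$, $F=CP\cdot AB$) and $D_3E_3F_3$ is the cevian triangle of $P'$. $T_P$ and $T_{P'}$ are the affine maps taking $ABC$ to $DEF$ and to $D_3E_3F_3$, respectively (vertices in order). The map $\mathsf{M}=T_P\circ K^{-1}\circ T_{P'}$ is a homothety or translation; its center $S$ is the fixed center of the homothety, respectively (for a translation) the infinite point in the direction of translation. Generalized isogonal map $\gamma_P$: let $h_a$ be the affine reflection about the line $AQ$ in the direction of $EF$ (i.e. $h_a(X)=X'$ with $XX'\parallel EF$ and the midpoint of $XX'$ on $AQ$), $h_b$ the affine reflection about $BQ$ in the direction $DF$, and $h_c$ the affine reflection about $CQ$ in the direction $DE$. For $X\neq A,B,C$, $\gamma_P(X)$ is the common point of the lines $Ah_a(X),Bh_b(X),Ch_c(X)$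 (which are concurrent). *)

theory Defs
  imports "HOL-Analysis.Analysis"
begin

section \<open>The extended Euclidean plane\<close>

text \<open>A direction is a parallel class of lines, encoded by the line of the class through 0;
  the points of the line at infinity are the directions.\<close>

typedef direction = "{U :: (real^2) set. subspace U \<and> dim U = 1}"
proof
  show "span {axis 1 1} \<in> {U :: (real^2) set. subspace U \<and> dim U = 1}"
    by (simp add: dim_eq_card_independent axis_eq_0_iff)
qed

text \<open>Meaningful for \<open>v \<noteq> 0\<close> only.\<close>

definition dir :: "real^2 \<Rightarrow> direction" where
  "dir v = Abs_direction (span {v})"

datatype point = Ordinary "real^2" | Infinite direction

definition is_line :: "point set \<Rightarrow> bool" where
  "is_line L \<longleftrightarrow> L = range Infinite \<or>
     (\<exists>a d. L = insert (Infinite d) (Ordinary ` {x. x - a \<in> Rep_direction d}))"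

text \<open>Meaningful for \<open>X \<noteq> Y\<close>, respectively \<open>L \<noteq> M\<close>.\<close>

definition line_join :: "point \<Rightarrow> point \<Rightarrow> point set" where
  "line_join X Y = (THE L. is_line L \<and> X \<in> L \<and> Y \<in> L)"

definition line_meet :: "point set \<Rightarrow> point set \<Rightarrow> point" where
  "line_meet L M = (THE X. X \<in> L \<and> X \<in> M)"

definition affine_map :: "(real^2 \<Rightarrow> real^2) \<Rightarrow> bool" where
  "affine_map f \<longleftrightarrow> linear (\<lambda>x. f x - f 0)"

text \<open>The extension to the line at infinity; meaningful for bijective affine maps.\<close>

fun extend :: "(real^2 \<Rightarrow> real^2) \<Rightarrow> point \<Rightarrow> point" where
  "extend f (Ordinary x) = Ordinary (f x)"
| "extend f (Infinite d) = Infinite (Abs_direction ((\<lambda>v. f v - f 0) ` Rep_direction d))"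

definition is_center :: "(real^2 \<Rightarrow> real^2) \<Rightarrow> point \<Rightarrow> bool" where
  "is_center f S \<longleftrightarrow>
     (\<exists>z k. k \<noteq> 0 \<and> k \<noteq> 1 \<and> (\<forall>x. f x = z + k *\<^sub>R (x - z)) \<and> S = Ordinary z) \<or>
     (\<exists>v. v \<noteq> 0 \<and> (\<forall>x. f x = x + v) \<and> S = Infinite (dir v))"

text \<open>Affine reflection about the line \<open>L\<close> in the direction of the line \<open>M\<close>.  The difference
  \<open>x' - x\<close> may be 0, which is the case of \<open>x\<close> lying on \<open>L\<close>.\<close>

definition affine_reflection :: "point set \<Rightarrow> point set \<Rightarrow> real^2 \<Rightarrow> real^2" where
  "affine_reflection L M x =
     (THE x'. (\<exists>d. Infinite d \<in> M \<and> x' - x \<in> Rep_direction d) \<and> Ordinary (midpoint x x') \<in> L)"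

section \<open>Triangle geometry\<close>

definition triangle_sides :: "real^2 \<Rightarrow> real^2 \<Rightarrow> real^2 \<Rightarrow> point set set" where
  "triangle_sides A B C =
     {line_join (Ordinary B) (Ordinary C), line_join (Ordinary C) (Ordinary A),
      line_join (Ordinary A) (Ordinary B)}"

definition centroid :: "real^2 \<Rightarrow> real^2 \<Rightarrow> real^2 \<Rightarrow> real^2" where
  "centroid A B C = (1/3) *\<^sub>R (A + B + C)"

definition complement_map :: "real^2 \<Rightarrow> real^2 \<Rightarrow> real^2 \<Rightarrow> real^2 \<Rightarrow> real^2" where
  "complement_map A B C x = centroid A B C + (-1/2) *\<^sub>R (x - centroid A B C)"

text \<open>The point with homogeneous barycentric coordinates \<open>(x : y : z)\<close>; coordinates with sum 0
  give the infinite points.\<close>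

definition barycentric :: "real^2 \<Rightarrow> real^2 \<Rightarrow> real^2 \<Rightarrow> real \<Rightarrow> real \<Rightarrow> real \<Rightarrow> point" where
  "barycentric A B C x y z =
     (if x + y + z \<noteq> 0
      then Ordinary ((1 / (x + y + z)) *\<^sub>R (x *\<^sub>R A + y *\<^sub>R B + z *\<^sub>R C))
      else Infinite (dir (x *\<^sub>R A + y *\<^sub>R B + z *\<^sub>R C)))"

text \<open>Defined for points not on the sides of the triangle.\<close>

definition isotomic :: "real^2 \<Rightarrow> real^2 \<Rightarrow> real^2 \<Rightarrow> point \<Rightarrow> point" where
  "isotomic A B C P =
     (THE P'. \<exists>x y z. x \<noteq> 0 \<and> y \<noteq> 0 \<and> z \<noteq> 0 \<and> P = barycentric A B C x y z \<and>
        P' = barycentric A B C (1/x) (1/y) (1/z))"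

text \<open>The trace on \<open>BC\<close> of the cevian from \<open>A\<close>.\<close>

definition cevian_trace :: "real^2 \<Rightarrow> real^2 \<Rightarrow> real^2 \<Rightarrow> point \<Rightarrow> point" where
  "cevian_trace A B C P =
     line_meet (line_join (Ordinary A) P) (line_join (Ordinary B) (Ordinary C))"

text \<open>The affine map \<open>T\<^sub>P\<close> taking \<open>ABC\<close> to the cevian triangle of \<open>P\<close>.  The traces are
  ordinary points when \<open>P\<close> is not on the sides of the anticomplementary triangle.\<close>

definition cevian_map :: "real^2 \<Rightarrow> real^2 \<Rightarrow> real^2 \<Rightarrow> point \<Rightarrow> real^2 \<Rightarrow> real^2" where
  "cevian_map A B C P =
     (THE f. affine_map f \<and>
        Ordinary (f A) = cevian_trace A B C P \<and>
        Ordinary (f B) = cevian_trace B C A P \<and>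
        Ordinary (f C) = cevian_trace C A B P)"

text \<open>The generalized isogonal map \<open>\<gamma>\<^sub>P\<close>, defined for \<open>X\<close> different from \<open>A\<close>, \<open>B\<close>, \<open>C\<close>.\<close>

definition generalized_isogonal :: "real^2 \<Rightarrow> real^2 \<Rightarrow> real^2 \<Rightarrow> point \<Rightarrow> point \<Rightarrow> point" where
  "generalized_isogonal A B C P X =
     (let Q = extend (complement_map A B C) (isotomic A B C P);
          D = cevian_trace A B C P; E = cevian_trace B C A P; F = cevian_trace C A B P;
          h\<^sub>a = affine_reflection (line_join (Ordinary A) Q) (line_join E F);
          h\<^sub>b = affine_reflection (line_join (Ordinary B) Q) (line_join D F);
          h\<^sub>c = affine_reflection (line_join (Ordinary C) Q) (line_join D E)
      in THE Y. Y \<in> line_join (Ordinary A) (extend h\<^sub>a X) \<and>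
                Y \<in> line_join (Ordinary B) (extend h\<^sub>b X) \<and>
                Y \<in> line_join (Ordinary C) (extend h\<^sub>c X))"

end

theory Submission imports Defs begin

text \<open>Both points have the same homogeneous barycentric coordinates.  If
  \<open>P = (x : y : z)\<close>, then each of them is
  \[ s = (x (y+z)^2 : y (z+x)^2 : z (x+y)^2). \]

  The center.  A real triple whose entries have sum 1 is the barycentric triple of a point, and an
  affine map is the restriction of a linear map on triples that preserves the sum of the entries.
  The linear map of the composite \<open>T\<^sub>P \<circ> inv K \<circ> T\<close>, where \<open>T\<close> takes \<open>ABC\<close> to the cevian triangle of
  \<open>P'\<close>, is
  \[ p \mapsto (\sigma(p) s - 4xyz p) / N, \quad N = (y+z)(z+x)(x+y), \]
  where \<open>\<sigma>(p)\<close> is the sum of the entries of \<open>p\<close> (\<open>composite_matrix\<close>).  It scales every triple of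
  sum 0 by a constant and has the eigenvector \<open>s\<close>, so that \<open>s\<close> is the fixed point if it has nonzero
  sum and the direction of translation if it has sum 0 (\<open>is_center_of_lift\<close>).

  The isogonal image.  Measured from \<open>A\<close>, with the coordinates \<open>(b, c)\<close> along \<open>AB\<close> and \<open>AC\<close>, the
  line \<open>AQ\<close> has the direction \<open>(m, n)\<close> with \<open>m = y(z+x)\<close> and \<open>n = z(x+y)\<close>, while \<open>EF\<close> has the
  direction \<open>(m, -n)\<close>.  Hence \<open>h\<^sub>a\<close> fixes \<open>(m, n)\<close> and negates \<open>(m, -n)\<close>; it exchanges the two sides
  by \<open>(b, c) \<mapsto> (c m / n, b n / m)\<close> and takes the line \<open>AP\<close>, where
  \<open>b : c = y : z\<close>, to the line where \<open>b : c = y(z+x)^2 : z(x+y)^2\<close> (\<open>isogonal_line\<close>).  The other two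
  lines follow by cyclic permutation, and \<open>s\<close> is the only point on all three
  (\<open>generalized_isogonal_self\<close>).

  Ordinary and infinite points, of \<open>P\<close>, \<open>Q\<close> and \<open>S\<close> alike, are treated at once, because joins,
  meets and extended affine maps are all described by triples up to scaling: the line through two
  points and the common point of two lines are cross products (\<open>line_join_pt\<close>,
  \<open>line_meet_line_of\<close>).\<close>

section \<open>Directions\<close>

lemma Rep_dir:
  assumes "v \<noteq> 0"
  shows "Rep_direction (dir v) = span {v}"
  unfolding dir_def using assms by (intro Abs_direction_inverse) simp

lemma direction_eq_dir: obtains v where "v \<noteq> 0" "d = dir v"
proof -
  have "subspace (Rep_direction d)" "dim (Rep_direction d) = 1"
    using Rep_direction[of d] by auto
  moreover obtain B where B: "B \<subseteq> Rep_direction d" "independent B" "Rep_direction d \<subseteq> span B"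
      "card B = dim (Rep_direction d)"
    using basis_exists by blast
  ultimately obtain v where v: "B = {v}"
    by (metis card_1_singletonE)
  have "Rep_direction d = span {v}"
    using B v \<open>subspace (Rep_direction d)\<close> by (metis span_minimal subset_antisym)
  then have "d = dir v"
    by (metis Rep_direction_inverse dir_def)
  moreover have "v \<noteq> 0"
    using B v by (auto simp: dependent_zero)
  ultimately show ?thesis
    by (rule that[rotated])
qed

lemma dir_eq_iff:
  assumes "v \<noteq> 0" "w \<noteq> 0"
  shows "dir v = dir w \<longleftrightarrow> (\<exists>c. w = c *\<^sub>R v)"
proof
  assume "dir v = dir w"
  then have "span {v} = span {w}"
    using assms by (metis Rep_dir)
  then have "w \<in> span {v}"
    by (simp add: span_base)
  then show "\<exists>c. w = c *\<^sub>R v"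
    by (auto simp: span_singleton)
next
  assume "\<exists>c. w = c *\<^sub>R v"
  then obtain c where c: "w = c *\<^sub>R v" "c \<noteq> 0"
    using assms by auto
  then have "v = (1/c) *\<^sub>R w"
    by simp
  then have "v \<in> span {w}" "w \<in> span {v}"
    using c by (metis singletonI span_base span_scale)+
  then have "span {v} = span {w}"
    by (simp add: span_eq)
  then show "dir v = dir w"
    by (simp add: dir_def)
qed

section \<open>Linear algebra of coordinate triples\<close>

lemma vec3_eqI: "p $ 1 = q $ 1 \<Longrightarrow> p $ 2 = q $ 2 \<Longrightarrow> p $ 3 = q $ 3 \<Longrightarrow> p = (q :: 'a^3)"
  by (simp add: vec_eq_iff forall_3)

lemma inner_vec3: "p \<bullet> q = p$1 * q$1 + p$2 * q$2 + p$3 * q$3" for p q :: "real^3"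
  by (simp add: inner_vec_def sum_3)

text \<open>Orthogonality to two independent vectors determines a vector up to a scalar.  This gives the
  uniqueness of the line through two points and, dually, of the common point of two lines.\<close>

lemma parallel_cross3:
  assumes "p \<bullet> l = 0" "p \<bullet> m = 0" "cross3 l m \<noteq> 0"
  obtains c where "p = c *\<^sub>R cross3 l m"
proof -
  have "cross3 (cross3 l m) p = 0"
    using assms by (simp add: cross_skew[of "cross3 l m"] Lagrange)
  then have "collinear {0, cross3 l m, p}"
    by (simp add: cross_eq_0)
  then show ?thesis
    using that assms(3) by (auto simp: collinear_lemma intro: exI[of _ 0])
qed

lemma in_plane_of_two:
  assumes "cross3 p q \<bullet> r = 0" "cross3 p q \<noteq> 0"
  obtains a b where "r = a *\<^sub>R p + b *\<^sub>R q"
proof -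
  define w where "w = cross3 p q"
  have "r \<bullet> w = 0" "w \<bullet> w \<noteq> 0"
    using assms by (simp_all add: w_def inner_commute)
  \<comment> \<open>Expanding the iterated cross product both ways exhibits the two coefficients.\<close>
  have "(w \<bullet> w) *\<^sub>R r = cross3 w (cross3 r w)"
    using \<open>r \<bullet> w = 0\<close> by (simp add: Lagrange inner_commute)
  also have "cross3 r w = (r \<bullet> q) *\<^sub>R p - (r \<bullet> p) *\<^sub>R q"
    by (simp add: w_def Lagrange)
  also have "cross3 w \<dots> = (r \<bullet> q) *\<^sub>R cross3 w p - (r \<bullet> p) *\<^sub>R cross3 w q"
    by (simp add: Cross3.right_diff_distrib cross_mult_right)
  also have "cross3 w p = (p \<bullet> p) *\<^sub>R q - (p \<bullet> q) *\<^sub>R p"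
    by (simp add: w_def cross_skew[of "cross3 p q"] Lagrange)
  also have "cross3 w q = (p \<bullet> q) *\<^sub>R q - (q \<bullet> q) *\<^sub>R p"
    by (simp add: w_def cross_skew[of "cross3 p q"] Lagrange inner_commute)
  finally have "(w \<bullet> w) *\<^sub>R r =
      ((r \<bullet> p) * (q \<bullet> q) - (r \<bullet> q) * (p \<bullet> q)) *\<^sub>R p +
      ((r \<bullet> q) * (p \<bullet> p) - (r \<bullet> p) * (p \<bullet> q)) *\<^sub>R q"
    by (simp add: algebra_simps)
  then have "r = (((r \<bullet> p) * (q \<bullet> q) - (r \<bullet> q) * (p \<bullet> q)) / (w \<bullet> w)) *\<^sub>R p +
      (((r \<bullet> q) * (p \<bullet> p) - (r \<bullet> p) * (p \<bullet> q)) / (w \<bullet> w)) *\<^sub>R q"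
    using \<open>w \<bullet> w \<noteq> 0\<close>
    by (metis (no_types, lifting) divide_inverse_commute scaleR_add_right scaleR_scaleR
        scaleR_one left_inverse)
  then show ?thesis
    by (rule that)
qed

lemma cyclic_product_sums:
  fixes x y z :: real
  shows "y * z + z * x = z * (x + y)" "z * x + x * y = x * (y + z)" "x * y + y * z = y * (z + x)"
  by (simp_all add: algebra_simps)

text \<open>Homogeneous coordinates belong to an ordinary point if the mass is nonzero and to a direction
  if it is 0.\<close>

definition mass :: "real^3 \<Rightarrow> real" where
  "mass p = p $ 1 + p $ 2 + p $ 3"

lemma linear_mass: "linear mass"
  by (rule linearI) (simp_all add: mass_def algebra_simps)

lemmas mass_simps [simp] = linear_add[OF linear_mass] linear_diff[OF linear_mass]
  linear_scale[OF linear_mass] linear_0[OF linear_mass] linear_neg[OF linear_mass]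

lemma mass_inner: "mass p = 1 \<bullet> p"
  by (simp add: mass_def inner_vec3)

text \<open>An ordinary point differs from an infinite one, hence their triples are independent.\<close>

lemma cross3_nonzero_of_mass:
  assumes "mass p \<noteq> 0" "mass q = 0" "q \<noteq> 0"
  shows "cross3 p q \<noteq> 0"
proof
  assume "cross3 p q = 0"
  moreover have "p \<noteq> 0"
    using assms(1) by auto
  ultimately have "\<exists>c. q = c *\<^sub>R p"
    using assms(3) by (simp add: cross_eq_0 collinear_lemma)
  then show False
    using assms by auto
qed

lemma cross3_vector:
  "cross3 (vector [a, b, c]) (vector [d, e, f]) =
    (vector [b * f - c * e, c * d - a * f, a * e - b * d] :: real^3)"
  by (simp add: cross3_def)

lemma vector_eq_0_iff: "(vector [a, b, c] :: real^3) = 0 \<longleftrightarrow> a = 0 \<and> b = 0 \<and> c = 0"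
  by (simp add: vec_eq_iff forall_3)

section \<open>Homogeneous barycentric coordinates\<close>

locale triangle =
  fixes A B C :: "real^2"
  assumes nondegenerate: "\<not> collinear {A, B, C}"
begin

definition combo :: "real^3 \<Rightarrow> real^2" where
  "combo p = p $ 1 *\<^sub>R A + p $ 2 *\<^sub>R B + p $ 3 *\<^sub>R C"

lemma linear_combo: "linear combo"
  by (rule linearI) (simp_all add: combo_def algebra_simps)

lemmas combo_simps [simp] = linear_add[OF linear_combo] linear_diff[OF linear_combo]
  linear_scale[OF linear_combo] linear_0[OF linear_combo] linear_neg[OF linear_combo]

text \<open>\<open>B - A\<close> and \<open>C - A\<close> are independent, so the pair \<open>(combo p, mass p)\<close> determines the triple
  \<open>p\<close>; by dimension, every pair occurs.\<close>

lemma combo_eq_0: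
  assumes "combo p = 0" "mass p = 0"
  shows "p = 0"
proof -
  have p1: "p $ 1 = - p $ 2 - p $ 3"
    using assms by (simp add: mass_def)
  have *: "p $ 2 *\<^sub>R (B - A) + p $ 3 *\<^sub>R (C - A) = 0"
    using assms(1) by (simp add: combo_def p1 algebra_simps)
  have nc: "\<not> collinear {0, B - A, C - A}"
    using nondegenerate collinear_3[of B A C] by (simp add: insert_commute)
  have "p $ 3 = 0"
  proof (rule ccontr)
    assume "p $ 3 \<noteq> 0"
    have "C - A = (1 / p $ 3) *\<^sub>R (p $ 3 *\<^sub>R (C - A))"
      using \<open>p $ 3 \<noteq> 0\<close> by simp
    also have "p $ 3 *\<^sub>R (C - A) = - (p $ 2 *\<^sub>R (B - A))"
      using * by (metis add.commute eq_neg_iff_add_eq_0)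
    finally have "C - A = (- p $ 2 / p $ 3) *\<^sub>R (B - A)"
      by simp
    then have "\<exists>c. C - A = c *\<^sub>R (B - A)" ..
    then show False
      using nc by (simp add: collinear_lemma)
  qed
  moreover from this have "p $ 2 = 0"
    using * nc by (auto simp: collinear_lemma)
  ultimately show "p = 0"
    using p1 by (simp add: vec3_eqI)
qed

lemma lift_eq: "combo p = combo q \<Longrightarrow> mass p = mass q \<Longrightarrow> p = q"
  using combo_eq_0[of "p - q"] by simp

lemma surj_combo_mass: "surj (\<lambda>p. (combo p, mass p))"
proof (rule linear_injective_imp_surjective)
  show "linear (\<lambda>p. (combo p, mass p))"
    by (rule linearI) simp_all
  show "inj (\<lambda>p. (combo p, mass p))"
    by (auto intro!: injI lift_eq)
qed (simp add: DIM_cart)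

definition coords :: "(real^2) \<times> real \<Rightarrow> real^3" where
  "coords = inv (\<lambda>p. (combo p, mass p))"

lemma combo_coords [simp]: "combo (coords (v, k)) = v"
  and mass_coords [simp]: "mass (coords (v, k)) = k"
  using surj_f_inv_f[OF surj_combo_mass, of "(v, k)"] by (simp_all add: coords_def)

definition pt :: "real^3 \<Rightarrow> point" where
  "pt p = barycentric A B C (p $ 1) (p $ 2) (p $ 3)"

lemma pt_alt:
  "pt p = (if mass p \<noteq> 0 then Ordinary ((1 / mass p) *\<^sub>R combo p) else Infinite (dir (combo p)))"
  by (simp add: pt_def barycentric_def mass_def combo_def)

lemma pt_eq_iff:
  assumes "p \<noteq> 0" "q \<noteq> 0"
  shows "pt p = pt q \<longleftrightarrow> (\<exists>c. q = c *\<^sub>R p)"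
proof
  assume eq: "pt p = pt q"
  show "\<exists>c. q = c *\<^sub>R p"
  proof (cases "mass p = 0")
    case True
    with eq have "mass q = 0" "dir (combo p) = dir (combo q)"
      by (auto simp: pt_alt split: if_splits)
    then obtain c where "combo q = c *\<^sub>R combo p"
      using assms True combo_eq_0 dir_eq_iff by metis
    then have "q = c *\<^sub>R p"
      using True \<open>mass q = 0\<close> by (intro lift_eq) simp_all
    then show ?thesis ..
  next
    case False
    with eq have "mass q \<noteq> 0" "(1 / mass p) *\<^sub>R combo p = (1 / mass q) *\<^sub>R combo q"
      by (auto simp: pt_alt split: if_splits)
    then have "combo q = mass q *\<^sub>R ((1 / mass p) *\<^sub>R combo p)"
      by simp
    then have "q = (mass q / mass p) *\<^sub>R p"
      using False by (intro lift_eq) simp_all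
    then show ?thesis ..
  qed
next
  assume "\<exists>c. q = c *\<^sub>R p"
  then obtain c where c: "q = c *\<^sub>R p" "c \<noteq> 0"
    using assms by auto
  show "pt p = pt q"
  proof (cases "mass p = 0")
    case True
    have "combo p \<noteq> 0" "combo q \<noteq> 0"
      using assms True c combo_eq_0 by auto
    then show ?thesis
      using True c by (auto simp: pt_alt dir_eq_iff)
  next
    case False
    then show ?thesis
      using c by (simp add: pt_alt)
  qed
qed

lemma pt_scale: "p \<noteq> 0 \<Longrightarrow> c \<noteq> 0 \<Longrightarrow> pt (c *\<^sub>R p) = pt p"
  by (metis pt_eq_iff scaleR_eq_0_iff)

lemma Ordinary_eq_pt: "Ordinary x = pt (coords (x, 1))"
  by (simp add: pt_alt)

lemma Infinite_eq_pt: "Infinite (dir v) = pt (coords (v, 0))"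
  by (simp add: pt_alt)

lemma point_eq_pt: obtains p where "p \<noteq> 0" "X = pt p"
proof (cases X)
  case (Ordinary x)
  have "mass (coords (x, 1)) \<noteq> 0"
    by simp
  then show ?thesis
    using that Ordinary Ordinary_eq_pt mass_simps(4) by metis
next
  case (Infinite d)
  obtain v where v: "v \<noteq> 0" "d = dir v"
    by (rule direction_eq_dir)
  have "combo (coords (v, 0)) \<noteq> 0"
    using v by simp
  then show ?thesis
    using that Infinite v Infinite_eq_pt combo_simps(4) by metis
qed

text \<open>A line is given by a triple \<open>l\<close> of coefficients.  The line at infinity has
  equal coefficients, since its equation is \<open>mass p = 0\<close>.\<close>

definition line_of :: "real^3 \<Rightarrow> point set" where
  "line_of l = {pt p |p. p \<noteq> 0 \<and> l \<bullet> p = 0}"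

lemma pt_in_line_of:
  assumes "p \<noteq> 0"
  shows "pt p \<in> line_of l \<longleftrightarrow> l \<bullet> p = 0"
proof
  assume "pt p \<in> line_of l"
  then obtain q where "q \<noteq> 0" "l \<bullet> q = 0" "pt q = pt p"
    by (auto simp: line_of_def)
  then show "l \<bullet> p = 0"
    using assms pt_eq_iff by (metis inner_scaleR_right mult_zero_right)
next
  assume "l \<bullet> p = 0"
  with assms show "pt p \<in> line_of l"
    unfolding line_of_def by blast
qed

lemma line_of_scale: "c \<noteq> 0 \<Longrightarrow> line_of (c *\<^sub>R l) = line_of l"
  by (simp add: line_of_def)

lemma line_of_1: "line_of 1 = range Infinite"
proof -
  have "X \<in> line_of 1 \<longleftrightarrow> X \<in> range Infinite" for X
  proof -
    obtain p where p: "p \<noteq> 0" "X = pt p"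
      by (rule point_eq_pt)
    then have "X \<in> line_of 1 \<longleftrightarrow> mass p = 0"
      by (simp add: pt_in_line_of mass_inner)
    also have "\<dots> \<longleftrightarrow> X \<in> range Infinite"
      using p by (auto simp: pt_alt)
    finally show ?thesis .
  qed
  then show ?thesis
    by blast
qed

text \<open>The span of an ordinary point and an infinite one consists of the infinite point and of the
  points \<open>a + t v\<close> with \<open>a = combo p\<close> and \<open>v = combo q\<close>: this compares an ordinary line with a linear equation.\<close>

lemma line_of_cross3:
  assumes "mass p = 1" "mass q = 0" "q \<noteq> 0"
  shows "insert (Infinite (dir (combo q)))
      (Ordinary ` {x. x - combo p \<in> Rep_direction (dir (combo q))}) = line_of (cross3 p q)"
    (is "?L = _")
proof -
  have [simp]: "combo q \<noteq> 0"
    using assms combo_eq_0 by blast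
  have "p \<noteq> 0"
    using assms by auto
  have nz: "cross3 p q \<noteq> 0"
    using assms by (simp add: cross3_nonzero_of_mass)
  have "X \<in> ?L \<longleftrightarrow> X \<in> line_of (cross3 p q)" for X
  proof
    assume "X \<in> ?L"
    then consider "X = Infinite (dir (combo q))"
      | t where "X = Ordinary (combo p + t *\<^sub>R combo q)"
      by (auto simp: Rep_dir span_singleton) (metis add.commute diff_add_cancel)
    then show "X \<in> line_of (cross3 p q)"
    proof cases
      case 1
      then have "X = pt q"
        using assms by (simp add: pt_alt)
      then show ?thesis
        using assms by (simp add: pt_in_line_of dot_cross_self)
    next
      case 2
      let ?r = "p + t *\<^sub>R q"
      have "mass ?r = 1"
        using assms by simp
      then have "?r \<noteq> 0"
        by (metis linear_0[OF linear_mass] zero_neq_one)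
      moreover have "X = pt ?r"
        using 2 assms by (simp add: pt_alt)
      ultimately show ?thesis
        by (simp add: pt_in_line_of inner_add_right dot_cross_self)
    qed
  next
    assume "X \<in> line_of (cross3 p q)"
    then obtain r where r: "r \<noteq> 0" "X = pt r" "cross3 p q \<bullet> r = 0"
      by (auto simp: line_of_def)
    then obtain a b where ab: "r = a *\<^sub>R p + b *\<^sub>R q"
      using nz in_plane_of_two by blast
    show "X \<in> ?L"
    proof (cases "a = 0")
      case True
      then have "X = pt q"
        using r ab assms by (auto simp: pt_scale)
      then show ?thesis
        using assms by (simp add: pt_alt)
    next
      case False
      then have "X = Ordinary (combo p + (b / a) *\<^sub>R combo q)"
        using r ab assms by (simp add: pt_alt algebra_simps)
      then show ?thesis
        by (auto simp: Rep_dir span_singleton)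
    qed
  qed
  then show ?thesis
    by blast
qed

text \<open>Conversely, a plane of triples other than \<open>mass p = 0\<close> meets that plane in the line spanned by
  the cross product \<open>q = l \<times> 1\<close>, which gives the direction, and \<open>l \<times> q\<close> is a vector of the plane with nonzero mass,
  which gives an ordinary point.\<close>

lemma is_line_iff: "is_line L \<longleftrightarrow> (\<exists>l. l \<noteq> 0 \<and> L = line_of l)"
proof
  assume "is_line L"
  then consider "L = range Infinite"
    | a d where "L = insert (Infinite d) (Ordinary ` {x. x - a \<in> Rep_direction d})"
    by (auto simp: is_line_def)
  then show "\<exists>l. l \<noteq> 0 \<and> L = line_of l"
  proof cases
    case 1
    then show ?thesis
      using line_of_1 by (metis zero_neq_one)
  next
    case 2
    obtain v where v: "v \<noteq> 0" "d = dir v"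
      by (rule direction_eq_dir)
    define p q where "p = coords (a, 1)" and "q = coords (v, 0)"
    have pq: "mass p = 1" "mass q = 0" "combo p = a" "combo q = v" "q \<noteq> 0" "p \<noteq> 0"
      using v by (auto simp: p_def q_def)
        (metis combo_coords combo_simps(4), metis mass_coords mass_simps(4) zero_neq_one)
    have "L = line_of (cross3 p q)"
      using line_of_cross3[of p q] 2 v pq by simp
    moreover have "cross3 p q \<noteq> 0"
      using pq by (simp add: cross3_nonzero_of_mass)
    ultimately show ?thesis
      by blast
  qed
next
  assume "\<exists>l. l \<noteq> 0 \<and> L = line_of l"
  then obtain l where l: "l \<noteq> 0" "L = line_of l"
    by blast
  define q where "q = cross3 l 1"
  show "is_line L"
  proof (cases "q = 0")
    case True
    then obtain c where "l = c *\<^sub>R 1"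
      using l cross_eq_0[of 1 l] cross_skew[of l 1] by (auto simp: q_def collinear_lemma)
    then show ?thesis
      using l line_of_1 line_of_scale by (auto simp: is_line_def)
  next
    case False
    \<comment> \<open>The factor makes \<open>p\<close> of mass 1, and then \<open>p \<times> q\<close> is \<open>l\<close> itself.\<close>
    define p where "p = (- 1 / (q \<bullet> q)) *\<^sub>R cross3 l q"
    have q: "mass q = 0"
      by (simp add: q_def mass_inner dot_cross_self)
    have "mass (cross3 l q) = - (q \<bullet> q)"
      unfolding mass_inner q_def by (metis cross_skew cross_triple inner_commute inner_minus_left)
    then have "mass p = 1"
      using False by (simp add: p_def)
    moreover have "cross3 p q = ((q \<bullet> q) / (q \<bullet> q)) *\<^sub>R l"
      by (simp add: p_def cross_mult_left cross_skew[of "cross3 l q"] Lagrange)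
        (simp add: q_def dot_cross_self)
    then have "cross3 p q = l"
      using False by simp
    ultimately have "L = insert (Infinite (dir (combo q)))
      (Ordinary ` {x. x - combo p \<in> Rep_direction (dir (combo q))})"
      using line_of_cross3[of p q] q False l by simp
    then show ?thesis
      unfolding is_line_def by blast
  qed
qed

lemma line_join_pt:
  assumes "p \<noteq> 0" "q \<noteq> 0" "cross3 p q \<noteq> 0"
  shows "line_join (pt p) (pt q) = line_of (cross3 p q)"
  unfolding line_join_def
proof (rule the_equality)
  show "is_line (line_of (cross3 p q)) \<and> pt p \<in> line_of (cross3 p q) \<and> pt q \<in> line_of (cross3 p q)"
    using assms by (auto simp: is_line_iff pt_in_line_of dot_cross_self)
next
  fix L assume "is_line L \<and> pt p \<in> L \<and> pt q \<in> L"
  then obtain l where l: "l \<noteq> 0" "L = line_of l" "l \<bullet> p = 0" "l \<bullet> q = 0"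
    using assms by (auto simp: is_line_iff pt_in_line_of)
  then obtain c where "l = c *\<^sub>R cross3 p q"
    using assms parallel_cross3 by blast
  then show "L = line_of (cross3 p q)"
    using l line_of_scale by auto
qed

lemma line_meet_line_of:
  assumes "cross3 l m \<noteq> 0"
  shows "line_meet (line_of l) (line_of m) = pt (cross3 l m)"
  unfolding line_meet_def
proof (rule the_equality)
  show "pt (cross3 l m) \<in> line_of l \<and> pt (cross3 l m) \<in> line_of m"
    using assms by (simp add: pt_in_line_of dot_cross_self)
next
  fix X assume X: "X \<in> line_of l \<and> X \<in> line_of m"
  obtain p where p: "p \<noteq> 0" "X = pt p"
    by (rule point_eq_pt)
  with X have "p \<bullet> l = 0" "p \<bullet> m = 0"
    by (simp_all add: pt_in_line_of inner_commute)
  then obtain c where "p = c *\<^sub>R cross3 l m"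
    using assms parallel_cross3 by blast
  then show "X = pt (cross3 l m)"
    using p pt_scale by auto
qed

section \<open>Affine maps in homogeneous coordinates\<close>

text \<open>The matrix of an affine map in barycentric coordinates.  Only triples of mass 1 are tested;
  linearity then determines the action of \<open>T\<close> on all triples, and with it the extension of the map to
  the line at infinity.\<close>

definition has_lift :: "(real^2 \<Rightarrow> real^2) \<Rightarrow> (real^3 \<Rightarrow> real^3) \<Rightarrow> bool" where
  "has_lift f T \<longleftrightarrow> linear T \<and> (\<forall>p. mass (T p) = mass p) \<and>
     (\<forall>p. mass p = 1 \<longrightarrow> f (combo p) = combo (T p))"

lemma has_liftI:
  assumes "linear T" "\<And>p. mass (T p) = mass p" "\<And>p. mass p = 1 \<Longrightarrow> f (combo p) = combo (T p)"
  shows "has_lift f T"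
  using assms by (simp add: has_lift_def)

lemma has_lift_compose:
  assumes "has_lift f T" "has_lift g U"
  shows "has_lift (f \<circ> g) (T \<circ> U)"
  using assms by (auto simp: has_lift_def linear_compose)

text \<open>The linear part of the map is the restriction of the lift to triples of mass 0.\<close>

lemma has_lift_diff:
  assumes "has_lift f T"
  shows "f v - f 0 = combo (T (coords (v, 0)))"
proof -
  have T: "linear T" "\<And>p. mass p = 1 \<Longrightarrow> f (combo p) = combo (T p)"
    using assms by (auto simp: has_lift_def)
  have "f v = combo (T (coords (v, 0) + coords (0, 1)))"
    using T(2)[of "coords (v, 0) + coords (0, 1)"] by simp
  moreover have "f 0 = combo (T (coords (0, 1)))"
    using T(2)[of "coords (0, 1)"] by simp
  ultimately show ?thesis
    by (simp add: linear_add[OF T(1)])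
qed

lemma has_lift_affine_map:
  assumes "has_lift f T"
  shows "affine_map f"
proof -
  have "linear T"
    using assms by (simp add: has_lift_def)
  moreover have "linear (\<lambda>v. coords (v, 0))"
  proof (rule linearI)
    show "coords (v + w, 0) = coords (v, 0) + coords (w, 0)" for v w
      by (rule lift_eq) simp_all
    show "coords (c *\<^sub>R v, 0) = c *\<^sub>R coords (v, 0)" for c v
      by (rule lift_eq) simp_all
  qed
  ultimately have "linear (combo \<circ> (T \<circ> (\<lambda>v. coords (v, 0))))"
    using linear_combo by (intro linear_compose)
  then show ?thesis
    by (simp add: affine_map_def has_lift_diff[OF assms] o_def)
qed

lemma extend_pt:
  assumes "has_lift f T" "p \<noteq> 0"
  shows "extend f (pt p) = pt (T p)"
proof -
  have T: "linear T" "mass (T p) = mass p" "\<And>p. mass p = 1 \<Longrightarrow> f (combo p) = combo (T p)"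
    using assms by (auto simp: has_lift_def)
  show ?thesis
  proof (cases "mass p = 0")
    case True
    have nz: "combo p \<noteq> 0"
      using assms True combo_eq_0 by auto
    have "f (c *\<^sub>R combo p) - f 0 = c *\<^sub>R combo (T p)" for c
    proof -
      have "coords (c *\<^sub>R combo p, 0) = c *\<^sub>R p"
        using True by (intro lift_eq) simp_all
      then show ?thesis
        by (simp add: has_lift_diff[OF assms(1)] linear_scale[OF T(1)])
    qed
    then have "(\<lambda>v. f v - f 0) ` span {combo p} = span {combo (T p)}"
      by (simp add: span_singleton image_image)
    then show ?thesis
      using True T(2) nz by (simp add: pt_alt Rep_dir dir_def[symmetric])
  next
    case False
    then have "f (combo ((1 / mass p) *\<^sub>R p)) = combo (T ((1 / mass p) *\<^sub>R p))"
      by (intro T(3)) simp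
    then show ?thesis
      using False T(2) by (simp add: pt_alt linear_scale[OF T(1)])
  qed
qed

lemma Ordinary_combo: "mass p = 1 \<Longrightarrow> Ordinary (combo p) = pt p"
  by (simp add: pt_alt)

lemma combo_vertex [simp]:
  "combo (vector [1, 0, 0]) = A" "combo (vector [0, 1, 0]) = B" "combo (vector [0, 0, 1]) = C"
  by (simp_all add: combo_def)

lemma pt_vertex:
  "Ordinary A = pt (vector [1, 0, 0])" "Ordinary B = pt (vector [0, 1, 0])"
  "Ordinary C = pt (vector [0, 0, 1])"
  by (simp_all add: pt_alt mass_def)

lemma affine_map_combo:
  assumes "affine_map f" "mass p = 1"
  shows "f (combo p) = p $ 1 *\<^sub>R f A + p $ 2 *\<^sub>R f B + p $ 3 *\<^sub>R f C"
proof -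
  let ?F = "\<lambda>v. f v - f 0"
  have F: "linear ?F"
    using assms by (simp add: affine_map_def)
  have "?F (combo p) = p $ 1 *\<^sub>R ?F A + p $ 2 *\<^sub>R ?F B + p $ 3 *\<^sub>R ?F C"
    unfolding combo_def by (simp only: linear_add[OF F] linear_scale[OF F])
  also have "\<dots> = p $ 1 *\<^sub>R f A + p $ 2 *\<^sub>R f B + p $ 3 *\<^sub>R f C - mass p *\<^sub>R f 0"
    by (simp add: mass_def algebra_simps)
  finally show ?thesis
    using assms(2) by simp
qed

lemma has_lift_of_linear:
  assumes "linear T" "\<And>p. mass (T p) = mass p"
  shows "has_lift (\<lambda>v. combo (T (coords (v, 1)))) T"
proof (rule has_liftI)
  fix p assume "mass p = 1"
  then have "coords (combo p, 1) = p"
    by (intro lift_eq) simp_all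
  then show "combo (T (coords (combo p, 1))) = combo (T p)"
    by simp
qed (use assms in auto)

text \<open>The triple \<open>e\<close> represents the infinite point of the line of \<open>m\<close>.  The reflection moves \<open>p\<close> by
  a multiple of \<open>e\<close>, and the midpoint \<open>p + (t/2) e\<close> lies on the axis \<open>l\<close> for exactly one \<open>t\<close>, because
  \<open>e\<close> does not.  The condition on \<open>m\<close> excludes the line at infinity, which has no single
  direction.\<close>

lemma has_lift_affine_reflection:
  assumes "mass e = 0" "l \<bullet> e \<noteq> 0" "m \<bullet> e = 0" "cross3 m 1 \<noteq> 0"
  shows "has_lift (affine_reflection (line_of l) (line_of m))
           (\<lambda>p. p - (2 * (l \<bullet> p) / (l \<bullet> e)) *\<^sub>R e)"
proof (rule has_liftI)
  show "linear (\<lambda>p. p - (2 * (l \<bullet> p) / (l \<bullet> e)) *\<^sub>R e)"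
    by (rule linearI) (simp_all add: inner_add_right algebra_simps add_divide_distrib)
  show "mass (p - (2 * (l \<bullet> p) / (l \<bullet> e)) *\<^sub>R e) = mass p" for p
    using assms by simp
  fix p assume p: "mass p = 1"
  have "e \<noteq> 0"
    using assms(2) by auto
  then have "combo e \<noteq> 0"
    using assms(1) combo_eq_0 by auto
  have dirs: "Infinite d \<in> line_of m \<longleftrightarrow> d = dir (combo e)" for d
  proof
    assume d: "Infinite d \<in> line_of m"
    obtain q where q: "q \<noteq> 0" "Infinite d = pt q"
      by (rule point_eq_pt)
    have "q \<bullet> m = 0"
      using d q by (simp add: pt_in_line_of inner_commute)
    moreover have "q \<bullet> 1 = 0"
      using q(2) by (auto simp: inner_commute pt_alt mass_inner split: if_splits)
    ultimately obtain b where b: "q = b *\<^sub>R cross3 m 1"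
      using assms parallel_cross3 by blast
    have "e \<bullet> m = 0" "e \<bullet> 1 = 0"
      using assms by (auto simp: inner_commute mass_inner)
    then obtain c where c: "e = c *\<^sub>R cross3 m 1"
      using assms parallel_cross3 by blast
    have "pt q = pt e"
      using b c q(1) \<open>e \<noteq> 0\<close> assms(4) by (simp add: pt_scale)
    then show "d = dir (combo e)"
      using q assms by (simp add: pt_alt)
  next
    assume "d = dir (combo e)"
    then have "Infinite d = pt e"
      using assms by (simp add: pt_alt)
    then show "Infinite d \<in> line_of m"
      using assms \<open>e \<noteq> 0\<close> by (simp add: pt_in_line_of)
  qed
  have on_axis: "Ordinary (midpoint (combo p) (combo p + t *\<^sub>R combo e)) \<in> line_of l \<longleftrightarrow>
      t = - 2 * (l \<bullet> p) / (l \<bullet> e)" for t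
  proof -
    let ?r = "p + (t / 2) *\<^sub>R e"
    have r: "mass ?r = 1" "midpoint (combo p) (combo p + t *\<^sub>R combo e) = combo ?r"
      using p assms by (simp_all add: midpoint_def algebra_simps)
    then have "?r \<noteq> 0"
      by (metis linear_0[OF linear_mass] zero_neq_one)
    then show ?thesis
      using r assms
      by (simp add: Ordinary_combo pt_in_line_of inner_add_right field_simps del: combo_simps mass_simps)
        (auto simp: algebra_simps)
  qed
  show "affine_reflection (line_of l) (line_of m) (combo p) =
      combo (p - (2 * (l \<bullet> p) / (l \<bullet> e)) *\<^sub>R e)" (is "_ = ?y")
    unfolding affine_reflection_def dirs
  proof (rule the_equality)
    have "?y = combo p + (- 2 * (l \<bullet> p) / (l \<bullet> e)) *\<^sub>R combo e"
      by simp
    moreover from this have "?y - combo p \<in> span {combo e}"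
      by (metis add_diff_cancel_left' insertI1 span_base span_scale)
    ultimately show "(\<exists>d. d = dir (combo e) \<and> ?y - combo p \<in> Rep_direction d) \<and>
        Ordinary (midpoint (combo p) ?y) \<in> line_of l"
      using on_axis Rep_dir[OF \<open>combo e \<noteq> 0\<close>] by metis
  next
    fix x'
    assume x': "(\<exists>d. d = dir (combo e) \<and> x' - combo p \<in> Rep_direction d) \<and>
        Ordinary (midpoint (combo p) x') \<in> line_of l"
    then obtain t where "x' - combo p = t *\<^sub>R combo e"
      using \<open>combo e \<noteq> 0\<close> by (auto simp: Rep_dir span_singleton)
    then have t: "x' = combo p + t *\<^sub>R combo e"
      by (simp add: algebra_simps)
    with x' on_axis have "t = - 2 * (l \<bullet> p) / (l \<bullet> e)"
      by auto
    with t show "x' = ?y"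
      by simp
  qed
qed

section \<open>Traces, isotomic conjugation and complement\<close>

lemma pt_vector: "pt (vector [x, y, z]) = barycentric A B C x y z"
  by (simp add: pt_def)

text \<open>Facts about one vertex are proved at \<open>A\<close>.  Interpreting the locale for \<open>BCA\<close> and \<open>CAB\<close>
  transports them to the other two.\<close>

lemma triangle_cyclic: "triangle B C A"
  using nondegenerate by (simp add: triangle_def insert_commute)

lemma barycentric_cyclic: "barycentric B C A y z x = barycentric A B C x y z"
  by (simp add: barycentric_def add.commute add.left_commute)

lemma line_BC: "line_join (Ordinary B) (Ordinary C) = line_of (vector [1, 0, 0])"
  by (simp add: pt_vertex line_join_pt cross3_vector vector_eq_0_iff)

lemma not_on_BC:
  assumes "(x, y, z) \<noteq> (0, 0, 0)"
    and "barycentric A B C x y z \<notin> line_join (Ordinary B) (Ordinary C)"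
  shows "x \<noteq> 0"
  using assms
  by (auto simp: line_BC pt_vector[symmetric] pt_in_line_of vector_eq_0_iff inner_vec3)

lemma cevian_trace_barycentric:
  assumes "y \<noteq> 0 \<or> z \<noteq> 0"
  shows "cevian_trace A B C (barycentric A B C x y z) = barycentric A B C 0 y z"
proof -
  have "line_join (Ordinary A) (barycentric A B C x y z) = line_of (vector [0, - z, y])"
    using assms
    by (auto simp: pt_vertex line_join_pt cross3_vector vector_eq_0_iff simp flip: pt_vector)
  then show ?thesis
    using assms
    by (auto simp: cevian_trace_def line_BC line_meet_line_of cross3_vector vector_eq_0_iff pt_vector)
qed

text \<open>The definite description picks one point, since rescaling \<open>(x, y, z)\<close> by \<open>k\<close> only rescales the
  reciprocals by \<open>1/k\<close>.  Clearing denominators keeps the coordinates polynomial.\<close>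

lemma isotomic_barycentric:
  assumes "x \<noteq> 0" "y \<noteq> 0" "z \<noteq> 0"
  shows "isotomic A B C (barycentric A B C x y z) = barycentric A B C (y * z) (z * x) (x * y)"
  unfolding isotomic_def
proof (rule the_equality)
  have "barycentric A B C (y * z) (z * x) (x * y) =
      pt ((x * y * z) *\<^sub>R vector [1 / x, 1 / y, 1 / z])"
    using assms by (simp add: pt_def mult.commute)
  also have "\<dots> = barycentric A B C (1 / x) (1 / y) (1 / z)"
    using assms by (simp add: pt_scale vector_eq_0_iff pt_vector)
  finally show "\<exists>a b c. a \<noteq> 0 \<and> b \<noteq> 0 \<and> c \<noteq> 0 \<and>
      barycentric A B C x y z = barycentric A B C a b c \<and>
      barycentric A B C (y * z) (z * x) (x * y) = barycentric A B C (1 / a) (1 / b) (1 / c)"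
    using assms by blast
next
  fix P'
  assume "\<exists>a b c. a \<noteq> 0 \<and> b \<noteq> 0 \<and> c \<noteq> 0 \<and>
      barycentric A B C x y z = barycentric A B C a b c \<and>
      P' = barycentric A B C (1 / a) (1 / b) (1 / c)"
  then obtain a b c where abc: "a \<noteq> 0" "b \<noteq> 0" "c \<noteq> 0"
      "pt (vector [x, y, z]) = pt (vector [a, b, c])" "P' = pt (vector [1 / a, 1 / b, 1 / c])"
    by (auto simp: pt_vector)
  then obtain k where "vector [a, b, c] = k *\<^sub>R (vector [x, y, z] :: real^3)"
    using assms by (auto simp: pt_eq_iff vector_eq_0_iff)
  then have k: "a = k * x" "b = k * y" "c = k * z"
    by (simp_all add: vec_eq_iff forall_3)
  then have "k \<noteq> 0"
    using abc(1) by auto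
  have "vector [y * z, z * x, x * y] = (k * (x * y * z)) *\<^sub>R (vector [1 / a, 1 / b, 1 / c] :: real^3)"
    using k \<open>k \<noteq> 0\<close> assms by (simp add: vec_eq_iff forall_3)
  then show "P' = barycentric A B C (y * z) (z * x) (x * y)"
    using abc k \<open>k \<noteq> 0\<close> assms by (simp add: pt_scale vector_eq_0_iff flip: pt_vector)
qed

lemma complement_combo:
  "mass p = 1 \<Longrightarrow> complement_map A B C (combo p) = combo ((1 / 2) *\<^sub>R (mass p *\<^sub>R 1 - p))"
  by (simp add: complement_map_def centroid_def combo_def vec_eq_iff; simp add: field_simps)

lemma has_lift_complement:
  "has_lift (complement_map A B C) (\<lambda>p. (1 / 2) *\<^sub>R (mass p *\<^sub>R 1 - p))"
proof (rule has_liftI)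
  show "linear (\<lambda>p. (1 / 2) *\<^sub>R (mass p *\<^sub>R 1 - p))"
    by (rule linearI) (simp_all add: algebra_simps)
  show "mass ((1 / 2) *\<^sub>R (mass p *\<^sub>R 1 - p)) = mass p" for p
    by (simp add: mass_def field_simps)
qed (rule complement_combo)

lemma inv_complement: "inv (complement_map A B C) = (\<lambda>v. A + B + C - 2 *\<^sub>R v)"
  by (rule inv_equality; simp add: complement_map_def centroid_def vec_eq_iff; simp add: field_simps)

lemma has_lift_inv_complement:
  "has_lift (inv (complement_map A B C)) (\<lambda>p. mass p *\<^sub>R 1 - 2 *\<^sub>R p)"
proof (rule has_liftI)
  show "linear (\<lambda>p. mass p *\<^sub>R 1 - 2 *\<^sub>R p)"
    by (rule linearI) (simp_all add: algebra_simps)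
  show "mass (mass p *\<^sub>R 1 - 2 *\<^sub>R p) = mass p" for p
    by (simp add: mass_def)
  show "inv (complement_map A B C) (combo p) = combo (mass p *\<^sub>R 1 - 2 *\<^sub>R p)" if "mass p = 1" for p
    using that by (simp add: inv_complement combo_def algebra_simps)
qed

text \<open>The line through the vertices \<open>(1 : -1 : 1)\<close> and \<open>(1 : 1 : -1)\<close> has the equation
  \<open>y + z = 0\<close>.  Off this line, the trace \<open>(0 : y : z)\<close> on \<open>BC\<close> is ordinary.\<close>

lemma not_on_anticomplementary_BC:
  fixes x y z :: real
  defines "K' \<equiv> inv (complement_map A B C)"
  assumes "(x, y, z) \<noteq> (0, 0, 0)"
    and "barycentric A B C x y z \<notin> line_join (Ordinary (K' B)) (Ordinary (K' C))"
  shows "y + z \<noteq> 0"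
proof -
  have "Ordinary (K' B) = pt (vector [1, -1, 1])" "Ordinary (K' C) = pt (vector [1, 1, -1])"
    by (simp_all add: K'_def inv_complement pt_alt mass_def combo_def scaleR_2)
  then have "line_join (Ordinary (K' B)) (Ordinary (K' C)) = line_of (vector [0, 2, 2])"
    by (simp add: line_join_pt cross3_vector vector_eq_0_iff)
  then show ?thesis
    using assms by (auto simp: pt_vector[symmetric] pt_in_line_of vector_eq_0_iff inner_vec3)
qed

lemma coordinates_off_sides:
  assumes "P \<notin> \<Union> (triangle_sides A B C)"
    and "P \<notin> \<Union> (triangle_sides (inv (complement_map A B C) A)
              (inv (complement_map A B C) B) (inv (complement_map A B C) C))"
  obtains x y z where "P = barycentric A B C x y z" "x \<noteq> 0" "y \<noteq> 0" "z \<noteq> 0"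
    "y + z \<noteq> 0" "z + x \<noteq> 0" "x + y \<noteq> 0"
proof -
  interpret BCA: triangle B C A
    by (rule triangle_cyclic)
  interpret CAB: triangle C A B
    by (rule BCA.triangle_cyclic)
  have K: "complement_map B C A = complement_map A B C" "complement_map C A B = complement_map A B C"
    by (simp_all add: fun_eq_iff complement_map_def centroid_def add.commute add.left_commute)
  obtain p where p: "p \<noteq> 0" "P = pt p"
    by (rule point_eq_pt)
  define x y z where "x = p $ 1" and "y = p $ 2" and "z = p $ 3"
  have nz: "(x, y, z) \<noteq> (0, 0, 0)" "(y, z, x) \<noteq> (0, 0, 0)" "(z, x, y) \<noteq> (0, 0, 0)"
    using p(1) by (auto simp: x_def y_def z_def vec_eq_iff forall_3)
  have P: "P = barycentric A B C x y z" "P = barycentric B C A y z x" "P = barycentric C A B z x y"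
    by (simp_all add: p(2) pt_def x_def y_def z_def barycentric_cyclic BCA.barycentric_cyclic)
  have off: "P \<notin> line_join (Ordinary B) (Ordinary C)" "P \<notin> line_join (Ordinary C) (Ordinary A)"
      "P \<notin> line_join (Ordinary A) (Ordinary B)"
    using assms(1) by (simp_all add: triangle_sides_def)
  let ?K' = "inv (complement_map A B C)"
  have off': "P \<notin> line_join (Ordinary (?K' B)) (Ordinary (?K' C))"
      "P \<notin> line_join (Ordinary (?K' C)) (Ordinary (?K' A))"
      "P \<notin> line_join (Ordinary (?K' A)) (Ordinary (?K' B))"
    using assms(2) by (simp_all add: triangle_sides_def)
  show ?thesis
  proof (rule that)
    show "x \<noteq> 0"
      using not_on_BC[OF nz(1)] off(1) P(1) by simp
    show "y \<noteq> 0"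
      using BCA.not_on_BC[OF nz(2)] off(2) P(2) by simp
    show "z \<noteq> 0"
      using CAB.not_on_BC[OF nz(3)] off(3) P(3) by simp
    show "y + z \<noteq> 0"
      using not_on_anticomplementary_BC[OF nz(1)] off'(1) P(1) by simp
    show "z + x \<noteq> 0"
      using BCA.not_on_anticomplementary_BC[OF nz(2)] off'(2) P(2) unfolding K by simp
    show "x + y \<noteq> 0"
      using CAB.not_on_anticomplementary_BC[OF nz(3)] off'(3) P(3) unfolding K by simp
  qed (fact P)
qed

text \<open>The coordinates of \<open>Q\<close>.  The point may be ordinary or infinite, according to whether
  \<open>xy + yz + zx\<close> is nonzero.\<close>

lemma complement_isotomic:
  assumes "x \<noteq> 0" "y \<noteq> 0" "z \<noteq> 0"
  shows "extend (complement_map A B C) (isotomic A B C (barycentric A B C x y z)) =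
    barycentric A B C (x * (y + z)) (y * (z + x)) (z * (x + y))"
proof -
  let ?p = "vector [y * z, z * x, x * y] :: real^3"
  have "extend (complement_map A B C) (isotomic A B C (barycentric A B C x y z)) =
      pt ((1 / 2) *\<^sub>R (mass ?p *\<^sub>R 1 - ?p))"
    using assms extend_pt[OF has_lift_complement, of ?p]
    by (simp add: isotomic_barycentric pt_vector vector_eq_0_iff del: mass_simps)
  also have "(1 / 2) *\<^sub>R (mass ?p *\<^sub>R 1 - ?p) =
      (1 / 2) *\<^sub>R vector [x * (y + z), y * (z + x), z * (x + y)]"
    by (intro vec3_eqI) (simp_all add: mass_def algebra_simps)
  also have "pt \<dots> = pt (vector [x * (y + z), y * (z + x), z * (x + y)])"
    \<comment> \<open>The triple is nonzero: two vanishing sums \<open>y + z\<close> and \<open>z + x\<close> give \<open>x = y\<close>, so \<open>x + y\<close> is not 0.\<close>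
    using assms by (intro pt_scale) (auto simp: vector_eq_0_iff)
  finally show ?thesis
    by (simp add: pt_vector)
qed

text \<open>The lift of \<open>T\<^sub>P\<close>: its columns are the traces \<open>D\<close>, \<open>E\<close>, \<open>F\<close>, normalized to mass 1.\<close>

definition cevian_matrix :: "real \<Rightarrow> real \<Rightarrow> real \<Rightarrow> real^3 \<Rightarrow> real^3" where
  "cevian_matrix x y z p =
     (p $ 1 / (y + z)) *\<^sub>R vector [0, y, z] + (p $ 2 / (z + x)) *\<^sub>R vector [x, 0, z] +
     (p $ 3 / (x + y)) *\<^sub>R vector [x, y, 0]"

lemma mass_cevian_matrix:
  assumes "y + z \<noteq> 0" "z + x \<noteq> 0" "x + y \<noteq> 0"
  shows "mass (cevian_matrix x y z p) = mass p"
proof -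
  have "mass (vector [0, y, z]) = y + z" "mass (vector [x, 0, z]) = z + x"
      "mass (vector [x, y, 0]) = x + y"
    by (simp_all add: mass_def)
  then show ?thesis
    using assms by (simp add: cevian_matrix_def mass_def[of p])
qed

lemma cevian_traces:
  assumes "y + z \<noteq> 0" "z + x \<noteq> 0" "x + y \<noteq> 0"
  shows "cevian_trace A B C (barycentric A B C x y z) = barycentric A B C 0 y z"
    and "cevian_trace B C A (barycentric A B C x y z) = barycentric A B C x 0 z"
    and "cevian_trace C A B (barycentric A B C x y z) = barycentric A B C x y 0"
proof -
  interpret BCA: triangle B C A
    by (rule triangle_cyclic)
  interpret CAB: triangle C A B
    by (rule BCA.triangle_cyclic)
  show "cevian_trace A B C (barycentric A B C x y z) = barycentric A B C 0 y z"
    using assms by (intro cevian_trace_barycentric) auto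
  show "cevian_trace B C A (barycentric A B C x y z) = barycentric A B C x 0 z"
    using assms BCA.cevian_trace_barycentric[of z x y] by (auto simp: barycentric_cyclic)
  show "cevian_trace C A B (barycentric A B C x y z) = barycentric A B C x y 0"
    using assms CAB.cevian_trace_barycentric[of x y z]
    by (auto simp: barycentric_cyclic BCA.barycentric_cyclic)
qed

lemma has_lift_cevian_map:
  assumes "y + z \<noteq> 0" "z + x \<noteq> 0" "x + y \<noteq> 0"
  shows "has_lift (cevian_map A B C (barycentric A B C x y z)) (cevian_matrix x y z)"
proof -
  let ?P = "barycentric A B C x y z" and ?T = "cevian_matrix x y z"
  have "linear ?T"
    by (rule linearI) (simp_all add: cevian_matrix_def algebra_simps add_divide_distrib)
  then obtain f where f: "has_lift f ?T"
    using assms has_lift_of_linear mass_cevian_matrix by blast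
  have vertex: "Ordinary (f (combo e)) = pt (?T e)" if "mass e = 1" for e
    using f that by (simp add: has_lift_def Ordinary_combo)
  have scale: "Ordinary (f (combo e)) = pt w" if "mass e = 1" "?T e = c *\<^sub>R w" "w \<noteq> 0" "c \<noteq> 0" for e c w
    using vertex that by (simp add: pt_scale)
  have traces: "Ordinary (f A) = cevian_trace A B C ?P"
      "Ordinary (f B) = cevian_trace B C A ?P" "Ordinary (f C) = cevian_trace C A B ?P"
    using assms
      scale[of "vector [1, 0, 0]" "1 / (y + z)" "vector [0, y, z]"]
      scale[of "vector [0, 1, 0]" "1 / (z + x)" "vector [x, 0, z]"]
      scale[of "vector [0, 0, 1]" "1 / (x + y)" "vector [x, y, 0]"]
    by (auto simp: cevian_traces mass_def cevian_matrix_def vector_eq_0_iff pt_vector)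
  have "cevian_map A B C ?P = f"
    unfolding cevian_map_def
  proof (rule the_equality)
    show "affine_map f \<and> Ordinary (f A) = cevian_trace A B C ?P \<and>
        Ordinary (f B) = cevian_trace B C A ?P \<and> Ordinary (f C) = cevian_trace C A B ?P"
      using has_lift_affine_map[OF f] traces by blast
  next
    fix g
    assume g: "affine_map g \<and> Ordinary (g A) = cevian_trace A B C ?P \<and>
        Ordinary (g B) = cevian_trace B C A ?P \<and> Ordinary (g C) = cevian_trace C A B ?P"
    then have eq: "g A = f A" "g B = f B" "g C = f C"
      using traces by (metis point.inject(1))+
    show "g = f"
    proof
      fix v
      have "g (combo (coords (v, 1))) = f (combo (coords (v, 1)))"
        using g has_lift_affine_map[OF f] by (simp add: affine_map_combo eq del: combo_coords)
      then show "g v = f v"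
        by simp
    qed
  qed
  with f show ?thesis
    by simp
qed

section \<open>The center of the composite map\<close>

text \<open>The coordinates of the center, and also of the generalized isogonal image of \<open>P\<close>.\<close>

definition center_coords :: "real \<Rightarrow> real \<Rightarrow> real \<Rightarrow> real^3" where
  "center_coords x y z = vector [x * (y + z)^2, y * (z + x)^2, z * (x + y)^2]"

lemma cevian_matrix_isotomic:
  assumes "x \<noteq> 0" "y \<noteq> 0" "z \<noteq> 0"
  shows "cevian_matrix (y * z) (z * x) (x * y) p =
    (p $ 1 / (y + z)) *\<^sub>R vector [0, z, y] + (p $ 2 / (z + x)) *\<^sub>R vector [z, 0, x] +
    (p $ 3 / (x + y)) *\<^sub>R vector [y, x, 0]"
  unfolding cevian_matrix_def cyclic_product_sums using assms by (simp add: vec_eq_iff forall_3)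

text \<open>By linearity and symmetry the identity amounts to its value at \<open>A\<close>, where the computation gives
  \<open>(x(y-z)^2, y(z+x)^2, z(x+y)^2) / N\<close>.  This is \<open>(s - 4xyz A) / N\<close>, because
  \<open>(y-z)^2 = (y+z)^2 - 4yz\<close>.\<close>

lemma composite_matrix:
  assumes "x \<noteq> 0" "y \<noteq> 0" "z \<noteq> 0" "y + z \<noteq> 0" "z + x \<noteq> 0" "x + y \<noteq> 0"
    and "q = cevian_matrix (y * z) (z * x) (x * y) p"
  shows "cevian_matrix x y z (mass q *\<^sub>R 1 - 2 *\<^sub>R q) =
    (1 / ((y + z) * (z + x) * (x + y))) *\<^sub>R
      (mass p *\<^sub>R center_coords x y z - (4 * x * y * z) *\<^sub>R p)"
proof -
  have q: "q $ 1 = p $ 2 * z / (z + x) + p $ 3 * y / (x + y)"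
      "q $ 2 = p $ 1 * z / (y + z) + p $ 3 * x / (x + y)"
      "q $ 3 = p $ 1 * y / (y + z) + p $ 2 * x / (z + x)"
    using assms(1-3) unfolding assms(7) cevian_matrix_isotomic[OF assms(1-3)] by simp_all
  have m: "mass q = p $ 1 + p $ 2 + p $ 3"
    using assms mass_cevian_matrix[of "z * x" "x * y" "y * z" p]
    by (simp add: cyclic_product_sums mass_def[of p])
  show ?thesis
    using assms(4-6)
    by (intro vec3_eqI; simp add: m q mass_def cevian_matrix_def center_coords_def;
        simp add: divide_simps; simp add: algebra_simps power2_eq_square)
qed

text \<open>Preservation of mass forces \<open>N = mass s - c\<close>.  A fixed point \<open>p\<close> of mass 1 then satisfies
  \<open>s = (mass s) p\<close>, so that it is the point of \<open>s\<close>.  In a translation by \<open>v\<close>, the vector \<open>N v\<close> is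
  \<open>s - (mass s) p\<close> at every \<open>p\<close> of mass 1; being independent of \<open>p\<close>, it forces \<open>mass s = 0\<close>, and \<open>v\<close>
  is parallel to \<open>s\<close>.\<close>

lemma is_center_of_lift:
  assumes "has_lift f T" "N \<noteq> 0" "s \<noteq> 0"
    and T: "\<And>p. T p = (1 / N) *\<^sub>R (mass p *\<^sub>R s - c *\<^sub>R p)"
    and "is_center f S"
  shows "S = pt s"
proof -
  have f: "f (combo p) = combo (T p)" "mass (T p) = mass p" if "mass p = 1" for p
    using assms(1) that by (auto simp: has_lift_def)
  have N: "N = mass s - c"
    using f(2)[of "vector [1, 0, 0]"] T[of "vector [1, 0, 0]"] assms(2)
    by (simp add: mass_def[of "vector [1, 0, 0]"] field_simps)
  from assms(5) consider z where "f z = z" "S = Ordinary z"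
    | v where "v \<noteq> 0" "\<And>x. f x = x + v" "S = Infinite (dir v)"
    by (auto simp: is_center_def)
  then show ?thesis
  proof cases
    case 1
    define p where "p = coords (z, 1)"
    have p: "mass p = 1" "combo p = z"
      by (simp_all add: p_def)
    have "T p = p"
      using f[of p] p 1 by (intro lift_eq) simp_all
    then have "N *\<^sub>R p = N *\<^sub>R T p"
      by simp
    also have "\<dots> = s - c *\<^sub>R p"
      using p assms(2) by (simp add: T)
    finally have "N *\<^sub>R p = s - c *\<^sub>R p" .
    then have "s = mass s *\<^sub>R p"
      by (simp add: N algebra_simps)
    then have "pt s = pt p"
      using assms(3) by (metis pt_scale scaleR_eq_0_iff)
    then show ?thesis
      using 1 p Ordinary_combo[of p] by simp
  next
    case 2
    have v: "N *\<^sub>R v = combo s - mass s *\<^sub>R combo p" if "mass p = 1" for p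
    proof -
      have "v = combo (T p) - combo p"
        using f(1) that 2(2) by (simp add: algebra_simps)
      then have "N *\<^sub>R v = N *\<^sub>R combo (T p) - N *\<^sub>R combo p"
        by (simp add: scaleR_diff_right)
      also have "N *\<^sub>R combo (T p) = combo s - c *\<^sub>R combo p"
        using that assms(2) by (simp add: T)
      finally show ?thesis
        by (simp add: N algebra_simps)
    qed
    have "A \<noteq> B"
      using nondegenerate by auto
    moreover have "mass s *\<^sub>R A = mass s *\<^sub>R B"
      using v[of "vector [1, 0, 0]"] v[of "vector [0, 1, 0]"] by (auto simp: mass_def[of "vector _"])
    ultimately have "mass s = 0"
      by simp
    then have s: "combo s = N *\<^sub>R v"
      using v[of "vector [1, 0, 0]"] by (simp add: mass_def[of "vector _"])
    then have "dir v = dir (combo s)"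
      using 2 assms(2) by (auto simp: dir_eq_iff)
    then show ?thesis
      using 2 \<open>mass s = 0\<close> by (simp add: pt_alt)
  qed
qed

lemma center_of_composite:
  assumes "x \<noteq> 0" "y \<noteq> 0" "z \<noteq> 0" "y + z \<noteq> 0" "z + x \<noteq> 0" "x + y \<noteq> 0"
    and "P = barycentric A B C x y z"
    and "is_center (cevian_map A B C P \<circ> inv (complement_map A B C)
            \<circ> cevian_map A B C (isotomic A B C P)) S"
  shows "S = pt (center_coords x y z)"
proof -
  have sums: "z * x + x * y \<noteq> 0" "x * y + y * z \<noteq> 0" "y * z + z * x \<noteq> 0"
    using assms(1-6) by (simp_all add: cyclic_product_sums)
  let ?T = "cevian_matrix x y z \<circ> (\<lambda>p. mass p *\<^sub>R 1 - 2 *\<^sub>R p) \<circ>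
    cevian_matrix (y * z) (z * x) (x * y)"
  have lift: "has_lift (cevian_map A B C P \<circ> inv (complement_map A B C)
      \<circ> cevian_map A B C (isotomic A B C P)) ?T"
    unfolding assms(7) isotomic_barycentric[OF assms(1-3)]
    using assms(4-6) sums by (intro has_lift_compose has_lift_cevian_map has_lift_inv_complement)
  have T: "?T p = (1 / ((y + z) * (z + x) * (x + y))) *\<^sub>R
      (mass p *\<^sub>R center_coords x y z - (4 * x * y * z) *\<^sub>R p)" for p
    unfolding comp_def by (rule composite_matrix[OF assms(1-6) refl])
  have "(y + z) * (z + x) * (x + y) \<noteq> 0" "center_coords x y z \<noteq> 0"
    using assms(1-6) by (simp_all add: center_coords_def vector_eq_0_iff)
  from is_center_of_lift[OF lift this T assms(8)] show ?thesis .
qed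

section \<open>The generalized isogonal image\<close>

text \<open>The reflection \<open>h\<^sub>a\<close> fixes \<open>A\<close>, so this line is the image of the cevian \<open>AP\<close>.  A point of
  the line \<open>AP\<close> has \<open>v : w = y : z\<close>; exchanging the sides \<open>AB\<close> and \<open>AC\<close> with the factors \<open>m / n\<close> and
  \<open>n / m\<close> turns this into \<open>v : w = z m^2 : y n^2\<close>, which is the ratio stated.\<close>

lemma isogonal_line:
  fixes x y z u v w :: real
  defines "P \<equiv> barycentric A B C x y z"
    and "Q \<equiv> barycentric A B C (x * (y + z)) (y * (z + x)) (z * (x + y))"
    and "E \<equiv> barycentric A B C x 0 z" and "F \<equiv> barycentric A B C x y 0"
  assumes "x \<noteq> 0" "y \<noteq> 0" "z \<noteq> 0" "z + x \<noteq> 0" "x + y \<noteq> 0" "(u, v, w) \<noteq> (0, 0, 0)"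
  shows "barycentric A B C u v w \<in>
      line_join (Ordinary A) (extend (affine_reflection (line_join (Ordinary A) Q) (line_join E F)) P)
    \<longleftrightarrow> v * (z * (x + y)^2) = w * (y * (z + x)^2)"
proof -
  define m n where "m = y * (z + x)" and "n = z * (x + y)"
  have mn: "m \<noteq> 0" "n \<noteq> 0"
    using assms by (simp_all add: m_def n_def)
  \<comment> \<open>\<open>l\<close> and \<open>k\<close> are the lines \<open>AQ\<close> and \<open>EF\<close>, and \<open>e\<close> is the infinite point of \<open>EF\<close>.\<close>
  define l :: "real^3" where "l = vector [0, -n, m]"
  define k :: "real^3" where "k = vector [- (y * z), z * x, x * y]"
  define e :: "real^3" where "e = vector [x * (z - y), m, -n]"
  define p :: "real^3" where "p = vector [x, y, z]"
  have AQ: "line_join (Ordinary A) Q = line_of l"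
    using mn by (simp add: Q_def pt_vertex line_join_pt cross3_vector vector_eq_0_iff l_def m_def n_def
        flip: pt_vector)
  have EF: "line_join E F = line_of k"
    using assms by (simp add: E_def F_def line_join_pt cross3_vector vector_eq_0_iff k_def mult.commute
        flip: pt_vector)
  have "mass e = 0" "k \<bullet> e = 0"
    by (simp_all add: mass_def inner_vec3 e_def k_def m_def n_def algebra_simps)
  moreover have le: "l \<bullet> e = - 2 * m * n"
    by (simp add: inner_vec3 e_def l_def)
  moreover have "cross3 k 1 \<noteq> 0"
  proof -
    \<comment> \<open>Two coefficients of \<open>EF\<close> differ, so it is not the line at infinity.\<close>
    have "cross3 k 1 $ 2 = m"
      by (simp add: cross_components k_def m_def algebra_simps)
    then show ?thesis
      using mn by auto
  qed
  ultimately have "extend (affine_reflection (line_of l) (line_of k)) P =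
      pt (p - (2 * (l \<bullet> p) / (l \<bullet> e)) *\<^sub>R e)"
    using mn assms extend_pt[OF has_lift_affine_reflection, of e l k p]
    by (simp add: P_def p_def vector_eq_0_iff pt_vector)
  also have "p - (2 * (l \<bullet> p) / (l \<bullet> e)) *\<^sub>R e =
      vector [x + x * (y - z)\<^sup>2 / ((z + x) * (x + y)), y * (z + x) / (x + y), z * (x + y) / (z + x)]"
    unfolding le using assms
    by (intro vec3_eqI) (simp_all add: inner_vec3 l_def p_def e_def m_def n_def divide_simps,
      simp_all add: algebra_simps power2_eq_square)
  finally have "line_join (Ordinary A) (extend (affine_reflection (line_of l) (line_of k)) P) =
      line_of (vector [0, - (z * (x + y) / (z + x)), y * (z + x) / (x + y)])"
    using assms by (simp add: pt_vertex line_join_pt cross3_vector vector_eq_0_iff)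
  then show ?thesis
    unfolding AQ EF using assms
    by (simp add: pt_in_line_of inner_vec3 vector_eq_0_iff divide_simps power2_eq_square
        mult.commute mult.left_commute flip: pt_vector) (auto simp: algebra_simps)
qed

lemma line_join_commute: "line_join X Y = line_join Y X"
  unfolding line_join_def by (rule arg_cong[of _ _ The]) auto

lemma generalized_isogonal_self:
  assumes "x \<noteq> 0" "y \<noteq> 0" "z \<noteq> 0" "y + z \<noteq> 0" "z + x \<noteq> 0" "x + y \<noteq> 0"
  shows "generalized_isogonal A B C (barycentric A B C x y z) (barycentric A B C x y z) =
    pt (center_coords x y z)"
proof -
  interpret BCA: triangle B C A
    by (rule triangle_cyclic)
  interpret CAB: triangle C A B
    by (rule BCA.triangle_cyclic)
  let ?P = "barycentric A B C x y z"
  let ?Q = "barycentric A B C (x * (y + z)) (y * (z + x)) (z * (x + y))"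
  let ?D = "barycentric A B C 0 y z" and ?E = "barycentric A B C x 0 z"
    and ?F = "barycentric A B C x y 0"
  let ?s = "center_coords x y z"
  let ?La = "line_join (Ordinary A)
    (extend (affine_reflection (line_join (Ordinary A) ?Q) (line_join ?E ?F)) ?P)"
  let ?Lb = "line_join (Ordinary B)
    (extend (affine_reflection (line_join (Ordinary B) ?Q) (line_join ?D ?F)) ?P)"
  let ?Lc = "line_join (Ordinary C)
    (extend (affine_reflection (line_join (Ordinary C) ?Q) (line_join ?D ?E)) ?P)"
  have La: "pt r \<in> ?La \<longleftrightarrow> r $ 2 * ?s $ 3 = r $ 3 * ?s $ 2" if "r \<noteq> 0" for r
    using isogonal_line[of x y z "r $ 1" "r $ 2" "r $ 3"] that assms
    by (simp add: pt_def center_coords_def vec_eq_iff forall_3)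
  have Lb: "pt r \<in> ?Lb \<longleftrightarrow> r $ 3 * ?s $ 1 = r $ 1 * ?s $ 3" if "r \<noteq> 0" for r
    using BCA.isogonal_line[of y z x "r $ 2" "r $ 3" "r $ 1"] that assms
    by (auto simp: barycentric_cyclic pt_def center_coords_def vec_eq_iff forall_3
        line_join_commute[of ?D])
  have Lc: "pt r \<in> ?Lc \<longleftrightarrow> r $ 1 * ?s $ 2 = r $ 2 * ?s $ 1" if "r \<noteq> 0" for r
    using CAB.isogonal_line[of z x y "r $ 3" "r $ 1" "r $ 2"] that assms
    by (auto simp: barycentric_cyclic BCA.barycentric_cyclic pt_def center_coords_def vec_eq_iff
        forall_3)
  have "?s \<noteq> 0"
    using assms by (simp add: center_coords_def vector_eq_0_iff)
  have "(THE Y. Y \<in> ?La \<and> Y \<in> ?Lb \<and> Y \<in> ?Lc) = pt ?s"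
  proof (rule the_equality)
    show "pt ?s \<in> ?La \<and> pt ?s \<in> ?Lb \<and> pt ?s \<in> ?Lc"
      using \<open>?s \<noteq> 0\<close> by (simp add: La Lb Lc)
  next
    fix Y assume Y: "Y \<in> ?La \<and> Y \<in> ?Lb \<and> Y \<in> ?Lc"
    obtain r where r: "r \<noteq> 0" "Y = pt r"
      by (rule point_eq_pt)
    with Y have "cross3 r ?s = 0"
      by (intro vec3_eqI) (simp_all add: La Lb Lc cross_components mult.commute)
    then obtain c where "?s = c *\<^sub>R r"
      using r(1) \<open>?s \<noteq> 0\<close> by (auto simp: cross_eq_0 collinear_lemma)
    then show "Y = pt ?s"
      using r \<open>?s \<noteq> 0\<close> pt_eq_iff by metis
  qed
  then show ?thesis
    using assms
    by (simp add: generalized_isogonal_def Let_def complement_isotomic cevian_traces)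
qed

end

theorem proposition2p3:
  fixes A B C :: "real^2" and P S :: point
  assumes "\<not> collinear {A, B, C}"
    and "P \<notin> \<Union> (triangle_sides A B C)"
    and "P \<notin> \<Union> (triangle_sides (inv (complement_map A B C) A)
                             (inv (complement_map A B C) B)
                             (inv (complement_map A B C) C))"
    and "is_center (cevian_map A B C P \<circ> inv (complement_map A B C)
                      \<circ> cevian_map A B C (isotomic A B C P)) S"
  shows "generalized_isogonal A B C P P = S"
proof -
  interpret triangle A B C
    using assms(1) by unfold_locales
  obtain x y z where P: "P = barycentric A B C x y z"
    and nz: "x \<noteq> 0" "y \<noteq> 0" "z \<noteq> 0" "y + z \<noteq> 0" "z + x \<noteq> 0" "x + y \<noteq> 0"
    using coordinates_off_sides[OF assms(2,3)] by blast
  have "S = pt (center_coords x y z)"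
    using center_of_composite[OF nz P assms(4)] .
  then show ?thesis
    using generalized_isogonal_self[OF nz] P by simp
qed

end
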